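(* Let $m,n\ge 1$ be integers, let $f\in\mathbb{R}^{m\times n}$, let $\mathcal{A}:\mathbb{R}^{m\times n}\to\mathbb{R}^{m\times n}$ be a linear operator, let $\omega\in\mathbb{R}^{m\times n}$ have all entries $\omega_{i,j}\in(0,1)$, and let $\lambda,\gamma,\iota,\mu_1,\mu_2,\mu_3>0$. Set $X=\mathbb{R}^{m\times n}$ and $\mathcal{D}=[0,\iota]^{m\times n}\subset X$. With the operators, norms and indicator function defined in the context, consider the constrained problem $$(P)\qquad \min_{g\in X,\ \mathbf{q}\in X^4,\ \mathbf{v}\in X^2,\ z\in X}\ \|f-\mathcal{A}g\|_2^2+\lambda\,|(1-\omega)\mathbf{q}|_1+\gamma\,|\omega\mathbf{v}|_1+\delta_{\mathcal{D}}(z)\quad\text{s.t.}\quad \mathbf{q}=\nabla^2 g,\ \ \mathbf{v}=\nabla g,\ \ z=g .$$ Assume that $\mathrm{Ker}(\mathcal{A})=\{0\}$ and that $(g^*,\mathbf{q}^*,\mathbf{v}^*,z^* )$ is the solution of $(P)$. Let $(g^0,\mathbf{q}^0,\mathbf{v}^0,z^0)\in X\times X^4\times X^2\times X$ be any initial point, with initial $\mathbf{b}^0\in X^4$, $\mathbf{c}^0\in X^2$, $d^0\in X$, and let the iterates be generated, for $k=0,1,2,\dots$, by $$\begin{aligned} g^{k+1}&=\operatorname*{argmin}_{g\in X}\ \|f-\mathcal{A}g\|_2^2+\tfrac{\mu_1}{2}\|\mathbf{b}^k+\nabla^2 g-\mathbf{q}^k\|_2^2+\tfrac{\mu_2}{2}\|\mathbf{c}^k+\nabla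 g-\mathbf{v}^k\|_2^2+\tfrac{\mu_3}{2}\|d^k+g-z^k\|_2^2,\\ \mathbf{q}^{k+1}&=\operatorname*{argmin}_{\mathbf{q}\in X^4}\ \lambda|(1-\omega)\mathbf{q}|_1+\tfrac{\mu_1}{2}\|\mathbf{b}^k+\nabla^2 g^{k+1}-\mathbf{q}\|_2^2,\\ \mathbf{v}^{k+1}&=\operatorname*{argmin}_{\mathbf{v}\in X^2}\ \gamma|\omega\mathbf{v}|_1+\tfrac{\mu_2}{2}\|\mathbf{c}^k+\nabla g^{k+1}-\mathbf{v}\|_2^2,\\ z^{k+1}&=\operatorname*{argmin}_{z\in X}\ \delta_{\mathcal{D}}(z)+\tfrac{\mu_3}{2}\|d^k+g^{k+1}-z\|_2^2,\\ \mathbf{b}^{k+1}&=\mathbf{b}^k+\nabla^2 g^{k+1}-\mathbf{q}^{k+1},\qquad \mathbf{c}^{k+1}=\mathbf{c}^k+\nabla g^{k+1}-\mathbf{v}^{k+1},\qquad d^{k+1}=d^k+g^{k+1}-z^{k+1}. \end{aligned}$$ Then the sequence $(g^k,\mathbf{q}^k,\mathbf{v}^k,z^k)$ converges to the solution $(g^*,\mathbf{q}^*,\mathbf{v}^*,z^* )$ of $(P)$ as $k\to\infty$.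
   Context: Discrete difference operators on $X=\mathbb{R}^{m\times n}$ with periodic boundary conditions: for $u\in X$, with the first index read modulo $m$ and the second modulo $n$, $$D_x^+u_{i,j}=u_{i+1,j}-u_{i,j},\quad D_y^+u_{i,j}=u_{i,j+1}-u_{i,j},\quad D_x^-u_{i,j}=u_{i,j}-u_{i-1,j},\quad D_y^-u_{i,j}=u_{i,j}-u_{i,j-1}.$$ The discrete gradient and discrete second-order operator are $$\nabla u=(D_x^+u,\ D_y^+u)\in X^2,\qquad \nabla^2u=\big(D_x^-(D_x^+u),\ D_x^-(D_y^+u),\ D_y^+(D_x^-u),\ D_y^+(D_y^-u)\big)\in X^4 .$$ Norms: for $\boldsymbol{\nu}=(\nu^1,\dots,\nu^\tau)\in X^\tau$, $$|\boldsymbol{\nu}|_1=\sum_{i=1}^m\sum_{j=1}^n\Big(\sum_{l=1}^\tau(\nu^l_{i,j})^2\Big)^{1/2},\qquad \|\boldsymbol{\nu}\|_2=\Big(\sum_{i=1}^m\sum_{j=1}^n\sum_{l=1}^\tau(\nu^l_{i,j})^2\Big)^{1/2}.$$ For a weight $w\in X$, $w\boldsymbol{\nu}$ denotes the pixelwise product $(w\boldsymbol{\nu})^l_{i,j}=w_{i,j}\nu^l_{i,j}$; thus, for example, $|(1-\omega)\mathbf{q}|_1=\sum_{i,j}(1-\omega_{i,j})\big(\sum_{l}(q^l_{i,j})^2\big)^{1/2}$. Indicator function: $\delta_{\mathcal{D}}(z)=0$ if $z\in\mathcal{D}$ and $\delta_{\mathcal{D}}(z)=+\infty$ otherwise. 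*)

theory Defs
  imports "HOL-Analysis.Analysis"
begin

text \<open>
  \<open>\<real>\<^sup>m\<^sup>\<times>\<^sup>n\<close> is \<open>real^'n^'m\<close>, with entry \<open>(i,j)\<close> written \<open>u $ i $ j\<close>; the synonym \<open>('n, 'm) img\<close>
  lists the column index type first, as \<open>real^'n^'m\<close> does.  The index types are
  arbitrary finite linear orders: such a type is order isomorphic to \<open>{0..<CARD('n)}\<close> by \<open>rank\<close>,
  and this provides the arithmetic on indices needed for the periodic boundary conditions.
\<close>

definition rank :: "'n::{finite,linorder} \<Rightarrow> nat" where
  "rank i = card {j. j < i}"

text \<open>\<open>shift i k\<close> is the index \<open>i + k\<close>, read modulo \<open>CARD('n)\<close>.\<close>

definition shift :: "'n::{finite,linorder} \<Rightarrow> int \<Rightarrow> 'n" where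
  "shift i k = (THE j. int (rank j) = (int (rank i) + k) mod int CARD('n))"

lemma rank_strict_mono: "i < j \<Longrightarrow> rank i < rank j"
  unfolding rank_def by (rule psubset_card_mono) auto

lemma rank_bij: "bij_betw (rank :: 'n::{finite,linorder} \<Rightarrow> nat) UNIV {0..<CARD('n)}"
proof -
  have inj: "inj (rank :: 'n \<Rightarrow> nat)"
    by (metis injI linorder_neqE less_irrefl rank_strict_mono)
  have "rank i < CARD('n)" for i :: 'n
    unfolding rank_def by (rule psubset_card_mono) auto
  then have sub: "range (rank :: 'n \<Rightarrow> nat) \<subseteq> {0..<CARD('n)}"
    by auto
  have "card (range (rank :: 'n \<Rightarrow> nat)) = CARD('n)"
    using inj by (rule card_image)
  then have "range (rank :: 'n \<Rightarrow> nat) = {0..<CARD('n)}"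
    using sub by (intro card_subset_eq) auto
  then show ?thesis
    using inj by (simp add: bij_betw_def)
qed

lemma rank_shift:
  fixes i :: "'n::{finite,linorder}"
  shows "int (rank (shift i k)) = (int (rank i) + k) mod int CARD('n)"
proof -
  define r where "r = (int (rank i) + k) mod int CARD('n)"
  have "0 \<le> r" "r < int CARD('n)"
    unfolding r_def by simp_all
  then have "nat r \<in> {0..<CARD('n)}"
    by auto
  then obtain j :: 'n where "rank j = nat r"
    using rank_bij[where 'n='n] unfolding bij_betw_def by (metis imageE)
  then have j: "int (rank j) = r"
    using \<open>0 \<le> r\<close> by simp
  have "\<And>j'::'n. int (rank j') = r \<Longrightarrow> j' = j"
    using j rank_bij[where 'n='n] unfolding bij_betw_def by (metis injD of_nat_eq_iff)
  with j have "int (rank (THE j::'n. int (rank j) = r)) = r"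
    by (rule theI)
  then show ?thesis
    by (simp add: shift_def r_def)
qed

type_synonym ('n, 'm) img = "((real, 'n) vec, 'm) vec"

definition Dxp :: "('n::finite, 'm::{finite,linorder}) img \<Rightarrow> ('n, 'm) img" where
  "Dxp u = (\<chi> i j. u $ shift i 1 $ j - u $ i $ j)"

definition Dyp :: "('n::{finite,linorder}, 'm::finite) img \<Rightarrow> ('n, 'm) img" where
  "Dyp u = (\<chi> i j. u $ i $ shift j 1 - u $ i $ j)"

definition Dxm :: "('n::finite, 'm::{finite,linorder}) img \<Rightarrow> ('n, 'm) img" where
  "Dxm u = (\<chi> i j. u $ i $ j - u $ shift i (-1) $ j)"

definition Dym :: "('n::{finite,linorder}, 'm::finite) img \<Rightarrow> ('n, 'm) img" where
  "Dym u = (\<chi> i j. u $ i $ j - u $ i $ shift j (-1))"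

definition grad ::
  "('n::{finite,linorder}, 'm::{finite,linorder}) img \<Rightarrow> ('n, 'm) img ^ 2" where
  "grad u = vector [Dxp u, Dyp u]"

definition grad2 ::
  "('n::{finite,linorder}, 'm::{finite,linorder}) img \<Rightarrow> ('n, 'm) img ^ 4" where
  "grad2 u = vector [Dxm (Dxp u), Dxm (Dyp u), Dyp (Dxm u), Dyp (Dym u)]"

lemma grad_nth: "grad u $ 1 = Dxp u" "grad u $ 2 = Dyp u"
  by (simp_all add: grad_def)

lemma grad2_nth:
  "grad2 u $ 1 = Dxm (Dxp u)" "grad2 u $ 2 = Dxm (Dyp u)"
  "grad2 u $ 3 = Dyp (Dxm u)" "grad2 u $ 4 = Dyp (Dym u)"
  by (simp_all add: grad2_def vector_def)

definition norm1 :: "('n::finite, 'm::finite) img ^ 't \<Rightarrow> real" where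
  "norm1 \<nu> = (\<Sum>i\<in>UNIV. \<Sum>j\<in>UNIV. sqrt (\<Sum>l\<in>UNIV. (\<nu> $ l $ i $ j)\<^sup>2))"

text \<open>
  The norm \<open>\<parallel>\<sqdot>\<parallel>\<^sub>2\<close> is the library norm of \<open>('n, 'm) img ^ 't\<close>, and that of
  \<open>('n, 'm) img\<close> for a single component.
\<close>

lemma norm_X: "norm u = sqrt (\<Sum>i\<in>UNIV. \<Sum>j\<in>UNIV. (u $ i $ j)\<^sup>2)"
  for u :: "('n::finite, 'm::finite) img"
  by (simp add: norm_vec_def L2_set_def sum_nonneg)

lemma norm_X_pow:
  "norm \<nu> = sqrt (\<Sum>i\<in>UNIV. \<Sum>j\<in>UNIV. \<Sum>l\<in>UNIV. (\<nu> $ l $ i $ j)\<^sup>2)"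
  for \<nu> :: "('n::finite, 'm::finite) img ^ 't"
proof -
  have "norm \<nu> = sqrt (\<Sum>l\<in>UNIV. \<Sum>i\<in>UNIV. \<Sum>j\<in>UNIV. (\<nu> $ l $ i $ j)\<^sup>2)"
    by (simp add: norm_vec_def L2_set_def sum_nonneg)
  also have "(\<Sum>l\<in>UNIV. \<Sum>i\<in>UNIV. \<Sum>j\<in>UNIV. (\<nu> $ l $ i $ j)\<^sup>2)
      = (\<Sum>i\<in>UNIV. \<Sum>l\<in>UNIV. \<Sum>j\<in>UNIV. (\<nu> $ l $ i $ j)\<^sup>2)"
    by (rule sum.swap)
  also have "\<dots> = (\<Sum>i\<in>UNIV. \<Sum>j\<in>UNIV. \<Sum>l\<in>UNIV. (\<nu> $ l $ i $ j)\<^sup>2)"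
    by (intro sum.cong refl sum.swap)
  finally show ?thesis .
qed

definition weight ::
  "('n::finite, 'm::finite) img \<Rightarrow> ('n, 'm) img ^ 't \<Rightarrow> ('n, 'm) img ^ 't" where
  "weight w \<nu> = (\<chi> l i j. w $ i $ j * \<nu> $ l $ i $ j)"

definition ind_fun :: "'a set \<Rightarrow> 'a \<Rightarrow> ereal" where
  "ind_fun D z = (if z \<in> D then 0 else \<infinity>)"

definition box_D :: "real \<Rightarrow> ('n::finite, 'm::finite) img set" where
  "box_D \<iota> = {z. \<forall>i j. z $ i $ j \<in> {0..\<iota>}}"

definition objective_P ::
  "('n::finite, 'm::finite) img \<Rightarrow> (('n, 'm) img \<Rightarrow> ('n, 'm) img) \<Rightarrow> ('n, 'm) img
     \<Rightarrow> real \<Rightarrow> real \<Rightarrow> real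
     \<Rightarrow> ('n, 'm) img \<times> (('n, 'm) img ^ 4) \<times> (('n, 'm) img ^ 2) \<times> ('n, 'm) img \<Rightarrow> ereal" where
  \<comment> \<open>The constant \<open>1\<close> of \<open>('n, 'm) img\<close> has all entries equal to one.\<close>
  "objective_P f A \<omega> lam \<gamma> \<iota> = (\<lambda>(g, q, v, z).
     ereal ((norm (f - A g))\<^sup>2 + lam * norm1 (weight (1 - \<omega>) q) + \<gamma> * norm1 (weight \<omega> v))
     + ind_fun (box_D \<iota>) z)"

definition feasible_P ::
  "('n::{finite,linorder}, 'm::{finite,linorder}) img \<times> (('n, 'm) img ^ 4) \<times> (('n, 'm) img ^ 2)
     \<times> ('n, 'm) img \<Rightarrow> bool" where
  "feasible_P = (\<lambda>(g, q, v, z). q = grad2 g \<and> v = grad g \<and> z = g)"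

end

theory Submission
  imports Defs
begin

text \<open>
  The iteration is a two-block ADMM, with blocks \<open>g\<close> and \<open>y = (q, v, z)\<close>, constraint \<open>y = K g\<close> for
  \<open>K g = (\<nabla>\<^sup>2 g, \<nabla> g, g)\<close>, scaled multiplier \<open>u = (b, c, d)\<close>, and penalty \<open>\<langle>M r, r\<rangle> / 2\<close> with
  \<open>M = diag(\<mu>1, \<mu>2, \<mu>3)\<close>.  Slater's condition gives a Lagrange multiplier \<open>M p\<close>.
  Comparing the optimality conditions of the iterates with those of the saddle point shows that
  \<open>V k = \<langle>M (u k - p), u k - p\<rangle> + \<langle>M (y k - K g*), y k - K g*\<rangle>\<close> decreases in each step by at least
  a multiple of \<open>\<parallel>g (k + 1) - g*\<parallel>\<^sup>2 + \<parallel>K g (k + 1) - y k\<parallel>\<^sup>2\<close>.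
  The first term comes from the strong convexity of \<open>\<parallel>f - A g\<parallel>\<^sup>2\<close>, as \<open>A\<close> is injective.
  Both terms tend to \<open>0\<close>, hence \<open>g k \<longlonglongrightarrow> g*\<close> and \<open>y k \<longlonglongrightarrow> K g*\<close>.
\<close>

section \<open>Optimality conditions and Lagrange multipliers\<close>

lemma quadratic_form_add:
  fixes M :: "'b::real_inner \<Rightarrow> 'b"
  assumes "linear M" and "\<And>x y. M x \<bullet> y = x \<bullet> M y"
  shows "M (x + y) \<bullet> (x + y) = M x \<bullet> x + 2 * (M x \<bullet> y) + M y \<bullet> y"
  using assms by (simp add: linear_add inner_add inner_commute)

text \<open>Comparing \<open>x\<close> with a point of the segment towards \<open>x'\<close>,
  dividing by \<open>t\<close> and letting \<open>t\<close> tend to 0 from the right leaves the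
  first-order condition. The gain \<open>s\<close> survives because \<open>t * (1 - t) / t\<close>
  tends to 1. Only points of the segment are compared, so the lemma covers both the strongly convex
  \<open>x\<close>-step on the whole space and, with \<open>s = 0\<close>, the \<open>y\<close>-step
  restricted to a convex set.\<close>

lemma minimizer_variational_inequality:
  fixes K :: "'a::real_vector \<Rightarrow> 'b::real_inner" and M :: "'b \<Rightarrow> 'b"
  assumes K: "linear K" and M: "linear M" and sym: "\<And>x y. M x \<bullet> y = x \<bullet> M y"
    and conv: "\<And>t. 0 < t \<Longrightarrow> t < 1 \<Longrightarrow>
      F ((1 - t) *\<^sub>R x + t *\<^sub>R x') \<le> (1 - t) * F x + t * F x' - s * (t * (1 - t))"
    and min: "\<And>t. 0 < t \<Longrightarrow> t < 1 \<Longrightarrow>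
      F x + M (a + K x) \<bullet> (a + K x) / 2
      \<le> F ((1 - t) *\<^sub>R x + t *\<^sub>R x')
        + M (a + K ((1 - t) *\<^sub>R x + t *\<^sub>R x')) \<bullet> (a + K ((1 - t) *\<^sub>R x + t *\<^sub>R x')) / 2"
  shows "F x + s \<le> F x' + M (a + K x) \<bullet> K (x' - x)"
proof -
  define h where "h = K (x' - x)"
  define G where "G = F x' - F x - s + M (a + K x) \<bullet> h"
  have "0 \<le> G + t * (s + M h \<bullet> h / 2)" if t: "0 < t" "t < 1" for t
  proof -
    have "a + K ((1 - t) *\<^sub>R x + t *\<^sub>R x') = (a + K x) + t *\<^sub>R h"
      by (simp add: h_def linear_add[OF K] linear_diff[OF K] linear_scale[OF K] algebra_simps)
    then have "F x + M (a + K x) \<bullet> (a + K x) / 2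
        \<le> (1 - t) * F x + t * F x' - s * (t * (1 - t))
          + (M (a + K x) \<bullet> (a + K x) + 2 * (t * (M (a + K x) \<bullet> h)) + t * (t * (M h \<bullet> h))) / 2"
      using min[OF t] conv[OF t] quadratic_form_add[OF M sym, of "a + K x" "t *\<^sub>R h"]
      by (simp add: linear_scale[OF M] add.assoc)
    then have "0 \<le> t * (G + t * (s + M h \<bullet> h / 2))"
      by (simp add: G_def field_simps)
    then show ?thesis
      using t by (simp add: zero_le_mult_iff)
  qed
  then have "\<forall>\<^sub>F t in at_right 0. 0 \<le> G + t * (s + M h \<bullet> h / 2)"
    unfolding eventually_at_right_field by (intro exI[of _ 1]) auto
  moreover have "((\<lambda>t. G + t * (s + M h \<bullet> h / 2)) \<longlongrightarrow> G + 0 * (s + M h \<bullet> h / 2)) (at_right 0)"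
    by (intro tendsto_intros)
  ultimately have "0 \<le> G + 0 * (s + M h \<bullet> h / 2)"
    by (intro tendsto_lowerbound) auto
  then show ?thesis
    by (simp add: G_def h_def)
qed

text \<open>
  The multiplier is the slope of a hyperplane that separates the origin from the set of perturbed
  constraint and objective values; Slater's condition \<open>K x0 \<in> interior C\<close> makes it non-vertical.
\<close>

lemma Lagrange_multiplier_exists:
  fixes K :: "'a::real_vector \<Rightarrow> 'b::euclidean_space"
  assumes K: "linear K" and F: "convex_on UNIV F" and H: "convex_on C H"
    and x0: "K x0 \<in> interior C" and xs: "K xs \<in> C"
    and opt: "\<And>x. K x \<in> C \<Longrightarrow> F xs + H (K xs) \<le> F x + H (K x)"
  obtains p where "\<And>x y. y \<in> C \<Longrightarrow> F xs + H (K xs) \<le> F x + H y + p \<bullet> (K x - y)"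
proof -
  define v where "v = F xs + H (K xs)"
  \<comment> \<open>Because of the strict inequality, the origin lies in \<open>S\<close> only if
    some feasible point has a value below the optimum \<open>v\<close>.\<close>
  define S where "S = {(w, t). \<exists>x. \<exists>y\<in>C. w = K x - y \<and> F x + H y - v < t}"
  have C: "convex C"
    using H by (simp add: convex_on_def)
  have "convex S"
    unfolding convex_alt
  proof (clarify)
    fix w1 w2 t1 t2 and r :: real
    assume r: "0 \<le> r" "r \<le> 1" and "(w1, t1) \<in> S" "(w2, t2) \<in> S"
    then obtain x1 y1 x2 y2 where 1: "y1 \<in> C" "w1 = K x1 - y1" "F x1 + H y1 - v < t1"
      and 2: "y2 \<in> C" "w2 = K x2 - y2" "F x2 + H y2 - v < t2"
      unfolding S_def by auto
    define x where "x = (1 - r) *\<^sub>R x1 + r *\<^sub>R x2"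
    define y where "y = (1 - r) *\<^sub>R y1 + r *\<^sub>R y2"
    have y: "y \<in> C"
      unfolding y_def using C r 1(1) 2(1) by (simp add: convex_alt)
    have w: "(1 - r) *\<^sub>R w1 + r *\<^sub>R w2 = K x - y"
      by (simp add: x_def y_def 1 2 linear_add[OF K] linear_scale[OF K] scaleR_right_diff_distrib)
    have "F x \<le> (1 - r) * F x1 + r * F x2" "H y \<le> (1 - r) * H y1 + r * H y2"
      unfolding x_def y_def using r 1(1) 2(1)
      by (auto intro!: convex_onD[OF F] convex_onD[OF H])
    then have "F x + H y - v \<le> (1 - r) * (F x1 + H y1 - v) + r * (F x2 + H y2 - v)"
      by (simp add: algebra_simps)
    \<comment> \<open>The bounds are shifted to the common value 0, so that strictness survives also
      for \<open>r = 0\<close> and \<open>r = 1\<close>.\<close>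
    also have "\<dots> < (1 - r) * t1 + r * t2"
      using convex_bound_lt[of "F x1 + H y1 - v - t1" 0 "F x2 + H y2 - v - t2" "1 - r" r] 1(3) 2(3) r
      by (simp add: algebra_simps)
    finally show "(1 - r) *\<^sub>R (w1, t1) + r *\<^sub>R (w2, t2) \<in> S"
      using y w unfolding S_def by auto
  qed
  moreover have "0 \<notin> S"
  proof
    assume "0 \<in> S"
    then obtain x where "K x \<in> C" "F x + H (K x) < v"
      by (auto simp: S_def zero_prod_def)
    then show False
      using opt[of x] by (simp add: v_def)
  qed
  ultimately obtain a where "a \<noteq> 0" and a: "\<And>s. s \<in> S \<Longrightarrow> 0 \<le> a \<bullet> s"
    using separating_hyperplane_set_0 by metis
  obtain p r where pr: "a = (p, r)"
    by (cases a)
  have sep: "0 \<le> p \<bullet> (K x - y) + r * t" if "y \<in> C" "F x + H y - v < t" for x y t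
    using a[of "(K x - y, t)"] that by (auto simp: S_def pr)
  \<comment> \<open>At the optimal pair the constraint part vanishes, which isolates
    \<open>r\<close>.\<close>
  have "0 \<le> r"
    using sep[OF xs, of xs 1] by (simp add: v_def)
  moreover have "r \<noteq> 0"
  proof
    assume "r = 0"
    obtain e where e: "e > 0" "cball (K x0) e \<subseteq> C"
      using x0 by (meson mem_interior_cball)
    \<comment> \<open>A step of length \<open>e\<close> from the Slater point along \<open>p\<close>
      stays in \<open>C\<close>, but \<open>p\<close> takes the negative value
      \<open>- e * norm p\<close> on \<open>K x0 - y\<close>; so a vertical hyperplane cannot
      separate.\<close>
    define y where "y = K x0 + (e / norm p) *\<^sub>R p"
    have "p \<noteq> 0"
      using \<open>a \<noteq> 0\<close> \<open>r = 0\<close> by (simp add: pr zero_prod_def)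
    then have "y \<in> C"
      using e by (auto simp: y_def dist_norm)
    then have "0 \<le> p \<bullet> (K x0 - y)"
      using sep[of y x0 "F x0 + H y - v + 1"] \<open>r = 0\<close> by simp
    moreover have "0 < (e / norm p) * (p \<bullet> p)"
      using e \<open>p \<noteq> 0\<close> by simp
    ultimately show False
      by (simp add: y_def)
  qed
  ultimately have r: "r > 0"
    by simp
  show thesis
  proof (rule that[of "p /\<^sub>R r"])
    fix x y
    assume y: "y \<in> C"
    show "F xs + H (K xs) \<le> F x + H y + (p /\<^sub>R r) \<bullet> (K x - y)"
    \<comment> \<open>Points of \<open>S\<close> lie strictly above the values of the problem, so
      the separation is available only with a slack \<open>e\<close>.\<close>
    proof (rule field_le_epsilon)
      fix e :: real
      assume "e > 0"
      then have "0 \<le> p \<bullet> (K x - y) + r * (F x + H y - v + e)"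
        by (intro sep y) auto
      then show "F xs + H (K xs) \<le> F x + H y + (p /\<^sub>R r) \<bullet> (K x - y) + e"
        using r by (simp add: v_def field_simps)
    qed
  qed
qed

section \<open>Convergence of the abstract two-block ADMM\<close>

text \<open>The constraint on the second block is carried by the set \<open>C\<close> instead of an
  infinite value, so \<open>F\<close> and \<open>H\<close> stay real-valued.\<close>

lemma ADMM_converges:
  fixes K :: "'a::euclidean_space \<Rightarrow> 'b::euclidean_space" and M :: "'b \<Rightarrow> 'b"
  assumes K: "linear K" and M: "linear M" and sym: "\<And>x y. M x \<bullet> y = x \<bullet> M y"
    and m: "m > 0" and coercive: "\<And>x. m * (norm x)\<^sup>2 \<le> M x \<bullet> x"
    and s: "s > 0" and F: "\<And>x x' t. 0 \<le> t \<Longrightarrow> t \<le> 1 \<Longrightarrow>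
      F ((1 - t) *\<^sub>R x + t *\<^sub>R x') \<le> (1 - t) * F x + t * F x' - s * (norm (x - x'))\<^sup>2 * (t * (1 - t))"
    and H: "convex_on C H"
    and x0: "K x0 \<in> interior C" and xs: "K xs \<in> C"
    and opt: "\<And>x. K x \<in> C \<Longrightarrow> F xs + H (K xs) \<le> F x + H (K x)"
    and x_min: "\<And>k x'. F (x (Suc k)) + M (u k + K (x (Suc k)) - y k) \<bullet> (u k + K (x (Suc k)) - y k) / 2
      \<le> F x' + M (u k + K x' - y k) \<bullet> (u k + K x' - y k) / 2"
    and y_mem: "\<And>k. y (Suc k) \<in> C"
    and y_min: "\<And>k y'. y' \<in> C \<Longrightarrow>
      H (y (Suc k)) + M (u k + K (x (Suc k)) - y (Suc k)) \<bullet> (u k + K (x (Suc k)) - y (Suc k)) / 2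
      \<le> H y' + M (u k + K (x (Suc k)) - y') \<bullet> (u k + K (x (Suc k)) - y') / 2"
    and u_step: "\<And>k. u (Suc k) = u k + K (x (Suc k)) - y (Suc k)"
  shows "x \<longlonglongrightarrow> xs" and "y \<longlonglongrightarrow> K xs"
proof -
  have C: "convex C"
    using H by (simp add: convex_on_def)
  have F_convex: "convex_on UNIV F"
  proof (rule convex_onI)
    fix t :: real and x x' :: 'a
    assume "0 < t" "t < 1"
    then have "0 \<le> s * (norm (x - x'))\<^sup>2 * (t * (1 - t))"
      using s by simp
    with F[of t x x'] \<open>0 < t\<close> \<open>t < 1\<close>
    show "F ((1 - t) *\<^sub>R x + t *\<^sub>R x') \<le> (1 - t) * F x + t * F x'"
      by linarith
  qed simp
  obtain p' where p': "\<And>x y. y \<in> C \<Longrightarrow> F xs + H (K xs) \<le> F x + H y + p' \<bullet> (K x - y)"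
    using Lagrange_multiplier_exists[OF K F_convex H x0 xs opt] by blast
  have "inj M"
    unfolding linear_injective_0[OF M]
  proof (intro allI impI)
    fix x assume "M x = 0"
    then have "m * (norm x)\<^sup>2 \<le> 0"
      using coercive[of x] by simp
    then show "x = 0"
      using m by (simp add: mult_le_0_iff)
  qed
  \<comment> \<open>In finite dimension injectivity gives surjectivity; the multiplier can then be
    written \<open>M p\<close>, the scaling in which it is comparable with
    \<open>u k\<close>.\<close>
  then have "surj M"
    by (simp add: linear_injective_imp_surjective M)
  then obtain p where p: "p' = M p"
    by (metis surjD)
  define V where "V k = M (u k - p) \<bullet> (u k - p) + M (y k - K xs) \<bullet> (y k - K xs)" for k
  define W where "W k = 2 * s * (norm (x (Suc k) - xs))\<^sup>2 + m * (norm (K (x (Suc k)) - y k))\<^sup>2" for k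
  have nonneg: "0 \<le> M w \<bullet> w" for w
    using coercive[of w] m by (smt (verit) mult_nonneg_nonneg zero_le_power2)
  have descent: "V (Suc k) + W k \<le> V k" for k
  proof -
    define x' y' u' where "x' = x (Suc k)" and "y' = y (Suc k)" and "u' = u (Suc k)"
    have u': "u' = u k + K x' - y'"
      by (simp add: u'_def x'_def y'_def u_step)
    have "F x' + s * (norm (x' - xs))\<^sup>2 \<le> F xs + M (u k - y k + K x') \<bullet> K (xs - x')"
    proof (rule minimizer_variational_inequality[OF K M sym])
      fix t :: real
      assume "0 < t" "t < 1"
      then show "F ((1 - t) *\<^sub>R x' + t *\<^sub>R xs)
          \<le> (1 - t) * F x' + t * F xs - s * (norm (x' - xs))\<^sup>2 * (t * (1 - t))"
        by (intro F) auto
    next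
      fix t :: real
      show "F x' + M (u k - y k + K x') \<bullet> (u k - y k + K x') / 2
          \<le> F ((1 - t) *\<^sub>R x' + t *\<^sub>R xs) + M (u k - y k + K ((1 - t) *\<^sub>R x' + t *\<^sub>R xs))
            \<bullet> (u k - y k + K ((1 - t) *\<^sub>R x' + t *\<^sub>R xs)) / 2"
        using x_min[of k "(1 - t) *\<^sub>R x' + t *\<^sub>R xs"] by (simp add: x'_def algebra_simps)
    qed
    moreover have "F xs \<le> F x' + M p \<bullet> (K x' - K xs)"
      using p'[OF xs, of x'] by (simp add: p)
    \<comment> \<open>The quadratic term is even, so its argument is negated to fit the shape
      \<open>a + y\<close> with the identity in place of \<open>K\<close>.\<close>
    moreover have "H y' + 0 \<le> H (K xs) + M (- (u k + K x') + y') \<bullet> (K xs - y')"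
    proof (rule minimizer_variational_inequality[OF linear_id[unfolded id_def] M sym])
      fix t :: real
      assume t: "0 < t" "t < 1"
      then show "H ((1 - t) *\<^sub>R y' + t *\<^sub>R K xs)
          \<le> (1 - t) * H y' + t * H (K xs) - 0 * (t * (1 - t))"
        using convex_onD[OF H, of t y' "K xs"] y_mem xs by (simp add: y'_def)
      have neg: "M (- w + z) \<bullet> (- w + z) = M (w - z) \<bullet> (w - z)" for w z
        using linear_neg[OF M, of "w - z"] by (simp add: inner_diff_right)
      have "(1 - t) *\<^sub>R y' + t *\<^sub>R K xs \<in> C"
        using C t y_mem xs by (simp add: convex_alt y'_def)
      then show "H y' + M (- (u k + K x') + y') \<bullet> (- (u k + K x') + y') / 2
          \<le> H ((1 - t) *\<^sub>R y' + t *\<^sub>R K xs) + M (- (u k + K x') + ((1 - t) *\<^sub>R y' + t *\<^sub>R K xs))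
            \<bullet> (- (u k + K x') + ((1 - t) *\<^sub>R y' + t *\<^sub>R K xs)) / 2"
        unfolding neg unfolding x'_def y'_def by (rule y_min)
    qed
    moreover have "H (K xs) \<le> H y' + M p \<bullet> (K xs - y')"
      using p'[of y' xs] y_mem by (simp add: p y'_def)
    moreover have "- (u k + K x') + y' = - u'"
      by (simp add: u')
    \<comment> \<open>On adding the two optimality conditions and the two saddle point inequalities,
      all values of \<open>F\<close> and \<open>H\<close> cancel.\<close>
    ultimately have *: "s * (norm (x' - xs))\<^sup>2 + M (u k - y k + K x') \<bullet> (K x' - K xs)
        + M u' \<bullet> (K xs - y') \<le> M p \<bullet> (K x' - K xs) + M p \<bullet> (K xs - y')"
      by (simp add: linear_diff[OF K] linear_neg[OF M] inner_diff_right)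
    \<comment> \<open>\<open>n\<close> and \<open>e\<close> are the old dual and primal errors,
      \<open>e'\<close> is the new primal error, and \<open>w\<close> is the residual of the new
      \<open>x\<close> against the old \<open>y\<close>. In these variables
      \<open>V (Suc k) - V k\<close> equals twice the cross terms of the next inequality minus
      \<open>M w \<bullet> w\<close>.\<close>
    define e where "e = y k - K xs"
    define n where "n = u k - p"
    define w where "w = K x' - y k"
    define e' where "e' = y' - K xs"
    have n': "u' - p = n + w + e - e'"
      by (simp add: n_def w_def e_def e'_def u')
    have "s * (norm (x' - xs))\<^sup>2 + M (n + w) \<bullet> (w + e) - M (n + w + e - e') \<bullet> e' \<le> 0"
    proof -
      have "n + w = (u k - y k + K x') - p" "w + e = K x' - K xs" "e' = - (K xs - y')"
        by (simp_all add: n_def w_def e_def e'_def)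
      then show ?thesis
        using * unfolding n'[symmetric]
        by (simp add: linear_diff[OF M] inner_diff)
    qed
    moreover have "M (n + w + e - e') \<bullet> (n + w + e - e')
        = M (n + w + e) \<bullet> (n + w + e) - 2 * (M (n + w + e - e') \<bullet> e') - M e' \<bullet> e'"
      using quadratic_form_add[OF M sym, of "n + w + e - e'" e'] by simp
    moreover have "M (n + w + e) \<bullet> (n + w + e)
        = M (n + w) \<bullet> (n + w) + 2 * (M (n + w) \<bullet> e) + M e \<bullet> e"
      by (rule quadratic_form_add[OF M sym])
    moreover have "M (n + w) \<bullet> (n + w) = M n \<bullet> n + 2 * (M n \<bullet> w) + M w \<bullet> w"
      by (rule quadratic_form_add[OF M sym])
    moreover have "M (n + w) \<bullet> (w + e) = M n \<bullet> w + M w \<bullet> w + M (n + w) \<bullet> e"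
      by (simp add: inner_add_right linear_add[OF M] inner_add_left)
    ultimately have "2 * s * (norm (x' - xs))\<^sup>2 + M w \<bullet> w
        + (M (n + w + e - e') \<bullet> (n + w + e - e') + M e' \<bullet> e') \<le> M n \<bullet> n + M e \<bullet> e"
      by linarith
    moreover have "m * (norm w)\<^sup>2 \<le> M w \<bullet> w"
      by (rule coercive)
    ultimately show ?thesis
      unfolding V_def W_def x'_def[symmetric] y'_def[symmetric] u'_def[symmetric] n'
        e_def[symmetric] e'_def[symmetric] n_def[symmetric] w_def[symmetric] by linarith
  qed
  have W_nonneg: "0 \<le> W k" for k
    using s m by (simp add: W_def)
  have "decseq V"
    using descent W_nonneg by (intro decseq_SucI) (smt (verit))
  moreover have "0 \<le> V k" for k
    by (simp add: V_def nonneg)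
  ultimately obtain l where "V \<longlonglongrightarrow> l"
    using decseq_convergent[of V 0] by blast
  \<comment> \<open>A convergent \<open>V\<close> has vanishing decrements, and these dominate
    \<open>W\<close>.\<close>
  then have "(\<lambda>k. V k - V (Suc k)) \<longlonglongrightarrow> l - l"
    by (intro tendsto_diff LIMSEQ_Suc)
  moreover have "W k \<le> V k - V (Suc k)" for k
    using descent[of k] by linarith
  ultimately have W: "W \<longlonglongrightarrow> 0"
    using W_nonneg by - (rule tendsto_sandwich[of "\<lambda>_. 0" W _ "\<lambda>k. V k - V (Suc k)"]; simp)
  have root_null: "h \<longlonglongrightarrow> 0" if "c > 0" "\<And>k. c * (norm (h k))\<^sup>2 \<le> W k"
    for c :: real and h :: "nat \<Rightarrow> 'c::real_normed_vector"
  proof -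
    have "(\<lambda>k. W k / c) \<longlonglongrightarrow> 0 / c"
      using \<open>c > 0\<close> by (intro tendsto_divide W) auto
    then have "(\<lambda>k. (norm (h k))\<^sup>2) \<longlonglongrightarrow> 0"
      using that by - (rule tendsto_sandwich[of "\<lambda>_. 0" _ _ "\<lambda>k. W k / c"]; simp add: field_simps)
    then have "(\<lambda>k. sqrt ((norm (h k))\<^sup>2)) \<longlonglongrightarrow> sqrt 0"
      by (rule tendsto_real_sqrt)
    then show ?thesis
      by (simp add: tendsto_norm_zero_iff)
  qed
  have "(\<lambda>k. x (Suc k) - xs) \<longlonglongrightarrow> 0"
    using s m by (intro root_null[of "2 * s"]) (auto simp: W_def)
  then have x_Suc: "(\<lambda>k. x (Suc k)) \<longlonglongrightarrow> xs"
    by (simp add: LIM_zero_iff)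
  then show "x \<longlonglongrightarrow> xs"
    by (rule LIMSEQ_imp_Suc)
  \<comment> \<open>The residual pairs the new \<open>x\<close> with the old \<open>y\<close>, so
    subtracting it from \<open>K (x (Suc k))\<close> recovers \<open>y k\<close> without an index
    shift.\<close>
  have "(\<lambda>k. K (x (Suc k)) - y k) \<longlonglongrightarrow> 0"
    using s m by (intro root_null[of m]) (auto simp: W_def)
  moreover have "(\<lambda>k. K (x (Suc k))) \<longlonglongrightarrow> K xs"
    using bounded_linear.tendsto K x_Suc unfolding linear_conv_bounded_linear by blast
  ultimately have "(\<lambda>k. K (x (Suc k)) - (K (x (Suc k)) - y k)) \<longlonglongrightarrow> K xs - 0"
    by (intro tendsto_diff)
  then show "y \<longlonglongrightarrow> K xs"
    by simp
qed

section \<open>Strong convexity of the data term\<close>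

lemma norm_convex_combination_sq:
  fixes a b :: "'a::real_inner"
  shows "(norm ((1 - t) *\<^sub>R a + t *\<^sub>R b))\<^sup>2
    = (1 - t) * (norm a)\<^sup>2 + t * (norm b)\<^sup>2 - (norm (a - b))\<^sup>2 * (t * (1 - t))"
  unfolding power2_norm_eq_inner
  by (simp add: inner_add inner_diff inner_commute algebra_simps)

text \<open>An injective linear map in finite dimension satisfies
  \<open>B * norm x \<le> norm (A x)\<close> with \<open>B > 0\<close>. The exact convexity defect
  of the squared norm then yields the modulus \<open>B\<^sup>2\<close>.\<close>

lemma least_squares_strongly_convex:
  fixes A :: "'a::euclidean_space \<Rightarrow> 'b::euclidean_space"
  assumes A: "linear A" and ker: "{x. A x = 0} = {0}"
  obtains s where "s > 0" "\<And>x x' t. 0 \<le> t \<Longrightarrow> t \<le> 1 \<Longrightarrow>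
      (norm (f - A ((1 - t) *\<^sub>R x + t *\<^sub>R x')))\<^sup>2
      \<le> (1 - t) * (norm (f - A x))\<^sup>2 + t * (norm (f - A x'))\<^sup>2 - s * (norm (x - x'))\<^sup>2 * (t * (1 - t))"
proof -
  have "inj A"
    using ker by (auto simp: linear_injective_0[OF A])
  then obtain B where B: "B > 0" "\<And>x. B * norm x \<le> norm (A x)"
    using linear_inj_bounded_below_pos[OF A] by metis
  show thesis
  proof (rule that[of "B\<^sup>2"])
    show "B\<^sup>2 > 0"
      using B by simp
    fix x x' and t :: real
    assume t: "0 \<le> t" "t \<le> 1"
    have "f - A ((1 - t) *\<^sub>R x + t *\<^sub>R x') = (1 - t) *\<^sub>R (f - A x) + t *\<^sub>R (f - A x')"
      by (simp only: linear_add[OF A] linear_scale[OF A]) (simp add: algebra_simps)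
    moreover have "B\<^sup>2 * (norm (x - x'))\<^sup>2 \<le> (norm ((f - A x) - (f - A x')))\<^sup>2"
    proof -
      have "norm (A (x - x')) = norm ((f - A x) - (f - A x'))"
        by (simp add: linear_diff[OF A] norm_minus_commute)
      then show ?thesis
        using power_mono[OF B(2)[of "x - x'"], of 2] B(1) by (simp add: power_mult_distrib)
    qed
    then have "B\<^sup>2 * (norm (x - x'))\<^sup>2 * (t * (1 - t))
        \<le> (norm ((f - A x) - (f - A x')))\<^sup>2 * (t * (1 - t))"
      using t by (intro mult_right_mono) auto
    ultimately show "(norm (f - A ((1 - t) *\<^sub>R x + t *\<^sub>R x')))\<^sup>2
      \<le> (1 - t) * (norm (f - A x))\<^sup>2 + t * (norm (f - A x'))\<^sup>2 - B\<^sup>2 * (norm (x - x'))\<^sup>2 * (t * (1 - t))"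
      by (simp add: norm_convex_combination_sq)
  qed
qed

section \<open>Difference operators, weighted norms and the box\<close>

lemma linear_grad: "linear grad"
  by (rule linearI)
    (simp_all add: vec_eq_iff forall_2 grad_nth Dxp_def Dyp_def algebra_simps)

lemma linear_grad2: "linear grad2"
  by (rule linearI)
    (simp_all add: vec_eq_iff forall_4 grad2_nth Dxp_def Dyp_def Dxm_def Dym_def algebra_simps)

lemma norm1_triangle: "norm1 (\<mu> + \<nu>) \<le> norm1 \<mu> + norm1 \<nu>"
  unfolding norm1_def L2_set_def[symmetric] sum.distrib[symmetric]
  by (intro sum_mono) (simp add: L2_set_triangle_ineq)

lemma norm1_scaleR: "norm1 (r *\<^sub>R \<nu>) = \<bar>r\<bar> * norm1 \<nu>"
  by (simp add: norm1_def power_mult_distrib sum_distrib_left[symmetric] real_sqrt_mult)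

lemma weight_add: "weight w (\<mu> + \<nu>) = weight w \<mu> + weight w \<nu>"
  by (simp add: weight_def vec_eq_iff algebra_simps)

lemma weight_scaleR: "weight w (r *\<^sub>R \<nu>) = r *\<^sub>R weight w \<nu>"
  by (simp add: weight_def vec_eq_iff)

lemma norm1_weight_convex_combination:
  assumes "0 \<le> t" "t \<le> 1"
  shows "norm1 (weight w ((1 - t) *\<^sub>R \<mu> + t *\<^sub>R \<nu>))
    \<le> (1 - t) * norm1 (weight w \<mu>) + t * norm1 (weight w \<nu>)"
  using norm1_triangle[of "(1 - t) *\<^sub>R weight w \<mu>" "t *\<^sub>R weight w \<nu>"] assms
  by (simp add: weight_add weight_scaleR norm1_scaleR)

lemma convex_box_D: "convex (box_D \<iota> :: ('n::finite, 'm::finite) img set)"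
proof -
  have "box_D \<iota> = (\<Inter>i. \<Inter>j. (\<lambda>z::('n, 'm) img. z $ i $ j) -` {0..\<iota>})"
    by (auto simp: box_D_def)
  moreover have "linear (\<lambda>z::('n, 'm) img. z $ i $ j)" for i j
    by (rule linearI) auto
  ultimately show ?thesis
    by (auto intro!: convex_INT convex_linear_vimage)
qed

lemma interior_box_D:
  fixes z :: "('n::finite, 'm::finite) img"
  assumes "\<And>i j. 0 < z $ i $ j" "\<And>i j. z $ i $ j < \<iota>"
  shows "z \<in> interior (box_D \<iota>)"
proof (rule interiorI)
  show "open (\<Inter>i. \<Inter>j. {z::('n, 'm) img. 0 < z $ i $ j} \<inter> {z. z $ i $ j < \<iota>})"
    by (intro open_INT finite ballI open_Int open_Collect_less continuous_intros)
qed (use assms in \<open>auto simp: box_D_def less_imp_le\<close>)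

section \<open>The image problem as an instance of the abstract iteration\<close>

theorem theorem3p2:
  fixes f \<omega> :: "('n::{finite,linorder}, 'm::{finite,linorder}) img"
    and A :: "('n, 'm) img \<Rightarrow> ('n, 'm) img"
    and lam \<gamma> \<iota> \<mu>1 \<mu>2 \<mu>3 :: real
    and g_star z_star :: "('n, 'm) img" and q_star :: "('n, 'm) img ^ 4" and v_star :: "('n, 'm) img ^ 2"
    and g z d :: "nat \<Rightarrow> ('n, 'm) img"
    and q b :: "nat \<Rightarrow> ('n, 'm) img ^ 4"
    and v c :: "nat \<Rightarrow> ('n, 'm) img ^ 2"
  assumes "linear A"
    and "\<And>i j. \<omega> $ i $ j \<in> {0<..<1}"
    and "lam > 0" "\<gamma> > 0" "\<iota> > 0" "\<mu>1 > 0" "\<mu>2 > 0" "\<mu>3 > 0"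
    and "{x. A x = 0} = {0}"
    and "is_arg_min (objective_P f A \<omega> lam \<gamma> \<iota>) feasible_P (g_star, q_star, v_star, z_star)"
    and "\<And>k. is_arg_min
           (\<lambda>x. (norm (f - A x))\<^sup>2
              + \<mu>1 / 2 * (norm (b k + grad2 x - q k))\<^sup>2
              + \<mu>2 / 2 * (norm (c k + grad x - v k))\<^sup>2
              + \<mu>3 / 2 * (norm (d k + x - z k))\<^sup>2)
           (\<lambda>_. True) (g (Suc k))"
    and "\<And>k. is_arg_min
           (\<lambda>x. lam * norm1 (weight (1 - \<omega>) x)
              + \<mu>1 / 2 * (norm (b k + grad2 (g (Suc k)) - x))\<^sup>2)
           (\<lambda>_. True) (q (Suc k))"
    and "\<And>k. is_arg_min
           (\<lambda>x. \<gamma> * norm1 (weight \<omega> x)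
              + \<mu>2 / 2 * (norm (c k + grad (g (Suc k)) - x))\<^sup>2)
           (\<lambda>_. True) (v (Suc k))"
    and "\<And>k. is_arg_min
           (\<lambda>x. ind_fun (box_D \<iota>) x
              + ereal (\<mu>3 / 2 * (norm (d k + g (Suc k) - x))\<^sup>2))
           (\<lambda>_. True) (z (Suc k))"
    and "\<And>k. b (Suc k) = b k + grad2 (g (Suc k)) - q (Suc k)"
    and "\<And>k. c (Suc k) = c k + grad (g (Suc k)) - v (Suc k)"
    and "\<And>k. d (Suc k) = d k + g (Suc k) - z (Suc k)"
  shows "(\<lambda>k. (g k, q k, v k, z k)) \<longlonglongrightarrow> (g_star, q_star, v_star, z_star)"
proof -
  define K where "K = (\<lambda>x::('n, 'm) img. (grad2 x, grad x, x))"
  define M where "M = (\<lambda>(q::('n, 'm) img ^ 4, v::('n, 'm) img ^ 2, z::('n, 'm) img). (\<mu>1 *\<^sub>R q, \<mu>2 *\<^sub>R v, \<mu>3 *\<^sub>R z))"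
  define C where "C = (UNIV :: (('n, 'm) img ^ 4) set) \<times> (UNIV :: (('n, 'm) img ^ 2) set) \<times> (box_D \<iota> :: ('n, 'm) img set)"
  define F where "F = (\<lambda>x. (norm (f - A x))\<^sup>2)"
  define H where "H = (\<lambda>(q::('n, 'm) img ^ 4, v::('n, 'm) img ^ 2, z::('n, 'm) img).
    lam * norm1 (weight (1 - \<omega>) q) + \<gamma> * norm1 (weight \<omega> v))"
  \<comment> \<open>The midpoint of the box is the Slater point; it also serves below as a
    competitor with finite objective value.\<close>
  define x0 :: "('n, 'm) img" where "x0 = (\<chi> i j. \<iota> / 2)"
  define m where "m = min \<mu>1 (min \<mu>2 \<mu>3)"
  define y where "y k = (q k, v k, z k)" for k
  define u where "u k = (b k, c k, d k)" for k
  have K: "linear K"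
    unfolding K_def
    by (rule linearI) (simp_all add: linear_add linear_scale linear_grad linear_grad2)
  have M: "linear M"
    unfolding M_def by (rule linearI) (auto simp: scaleR_add_right split: prod.splits)
  have sym: "M x \<bullet> y = x \<bullet> M y" for x y
    by (simp add: M_def split: prod.splits)
  have Mq: "M (q', v', z') \<bullet> (q', v', z') / 2
      = \<mu>1 / 2 * (norm q')\<^sup>2 + \<mu>2 / 2 * (norm v')\<^sup>2 + \<mu>3 / 2 * (norm z')\<^sup>2" for q' v' z'
    by (simp add: M_def power2_norm_eq_inner add_divide_distrib)
  have m: "m > 0"
    using assms by (simp add: m_def)
  have coercive: "m * (norm x)\<^sup>2 \<le> M x \<bullet> x" for x
  proof -
    obtain q' v' z' where x: "x = (q', v', z')"
      by (cases x)
    have "m * (q' \<bullet> q') \<le> \<mu>1 * (q' \<bullet> q')" "m * (v' \<bullet> v') \<le> \<mu>2 * (v' \<bullet> v')" "m * (z' \<bullet> z') \<le> \<mu>3 * (z' \<bullet> z')"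
      by (intro mult_right_mono; simp add: m_def)+
    then show ?thesis
      by (simp add: x M_def power2_norm_eq_inner algebra_simps)
  qed
  obtain s where s: "s > 0" "\<And>x x' t. 0 \<le> t \<Longrightarrow> t \<le> 1 \<Longrightarrow>
      F ((1 - t) *\<^sub>R x + t *\<^sub>R x') \<le> (1 - t) * F x + t * F x' - s * (norm (x - x'))\<^sup>2 * (t * (1 - t))"
    using least_squares_strongly_convex[OF assms(1) assms(9), of f] unfolding F_def by metis
  have H: "convex_on C H"
  proof (rule convex_onI)
    show "convex C"
      unfolding C_def by (intro convex_Times convex_UNIV convex_box_D)
    fix t :: real and y1 y2
    assume t: "0 < t" "t < 1"
    obtain q1 q2 :: "('n, 'm) img ^ 4" and v1 v2 :: "('n, 'm) img ^ 2" and z1 z2 :: "('n, 'm) img"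
      where y: "y1 = (q1, v1, z1)" "y2 = (q2, v2, z2)"
      by (cases y1; cases y2)
    have "lam * norm1 (weight (1 - \<omega>) ((1 - t) *\<^sub>R q1 + t *\<^sub>R q2))
        \<le> lam * ((1 - t) * norm1 (weight (1 - \<omega>) q1) + t * norm1 (weight (1 - \<omega>) q2))"
      "\<gamma> * norm1 (weight \<omega> ((1 - t) *\<^sub>R v1 + t *\<^sub>R v2))
        \<le> \<gamma> * ((1 - t) * norm1 (weight \<omega> v1) + t * norm1 (weight \<omega> v2))"
      using assms(3,4) t by (auto intro!: mult_left_mono norm1_weight_convex_combination)
    then show "H ((1 - t) *\<^sub>R y1 + t *\<^sub>R y2) \<le> (1 - t) * H y1 + t * H y2"
      by (simp add: y H_def algebra_simps)
  qed
  have x0: "K x0 \<in> interior C"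
    using assms(5) by (auto simp: C_def K_def interior_Times x0_def intro!: interior_box_D)
  then have x0_mem: "x0 \<in> box_D \<iota>"
    using interior_subset[of C] by (auto simp: C_def K_def)
  have star: "q_star = grad2 g_star" "v_star = grad g_star" "z_star = g_star"
    using assms(10) by (auto simp: is_arg_min_def feasible_P_def)
  have obj: "objective_P f A \<omega> lam \<gamma> \<iota> (x, grad2 x, grad x, x)
      = (if x \<in> box_D \<iota> then ereal (F x + H (K x)) else \<infinity>)" for x
    by (simp add: objective_P_def F_def H_def K_def ind_fun_def)
  have star_min: "objective_P f A \<omega> lam \<gamma> \<iota> (g_star, grad2 g_star, grad g_star, g_star)
      \<le> objective_P f A \<omega> lam \<gamma> \<iota> (x, grad2 x, grad x, x)" for x
    using assms(10) by (auto simp: is_arg_min_linorder feasible_P_def)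
  \<comment> \<open>Outside the box the objective is infinite, which the finite value at
    \<open>x0\<close> rules out for a minimizer.\<close>
  have g_star_mem: "g_star \<in> box_D \<iota>"
    using star_min[of x0] x0_mem by (auto simp: obj split: if_splits)
  have opt: "F g_star + H (K g_star) \<le> F x + H (K x)" if "K x \<in> C" for x
    using star_min[of x] that g_star_mem by (simp add: obj C_def K_def)
  have g_min: "F (g (Suc k)) + M (u k + K (g (Suc k)) - y k) \<bullet> (u k + K (g (Suc k)) - y k) / 2
      \<le> F x + M (u k + K x - y k) \<bullet> (u k + K x - y k) / 2" for k x
    using assms(11)[of k] by (simp add: is_arg_min_linorder F_def u_def y_def K_def Mq add.assoc)
  have z_min: "ind_fun (box_D \<iota>) (z (Suc k)) + ereal (\<mu>3 / 2 * (norm (d k + g (Suc k) - z (Suc k)))\<^sup>2)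
      \<le> ind_fun (box_D \<iota>) z' + ereal (\<mu>3 / 2 * (norm (d k + g (Suc k) - z'))\<^sup>2)" for k z'
    using assms(14)[of k] by (auto simp: is_arg_min_linorder)
  have z_mem: "z (Suc k) \<in> box_D \<iota>" for k
    using z_min[of k x0] x0_mem by (auto simp: ind_fun_def split: if_splits)
  \<comment> \<open>\<open>M\<close> is block diagonal and \<open>H\<close> is separable, so the
    three separate minimality statements add up to joint minimality over \<open>C\<close>.\<close>
  have y_min: "H (y (Suc k)) + M (u k + K (g (Suc k)) - y (Suc k)) \<bullet> (u k + K (g (Suc k)) - y (Suc k)) / 2
      \<le> H y' + M (u k + K (g (Suc k)) - y') \<bullet> (u k + K (g (Suc k)) - y') / 2" if "y' \<in> C" for k y'
  proof -
    obtain q' v' z' where y': "y' = (q', v', z')"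
      by (cases y')
    have "lam * norm1 (weight (1 - \<omega>) (q (Suc k))) + \<mu>1 / 2 * (norm (b k + grad2 (g (Suc k)) - q (Suc k)))\<^sup>2
        \<le> lam * norm1 (weight (1 - \<omega>) q') + \<mu>1 / 2 * (norm (b k + grad2 (g (Suc k)) - q'))\<^sup>2"
      using assms(12)[of k] by (auto simp: is_arg_min_linorder)
    moreover have "\<gamma> * norm1 (weight \<omega> (v (Suc k))) + \<mu>2 / 2 * (norm (c k + grad (g (Suc k)) - v (Suc k)))\<^sup>2
        \<le> \<gamma> * norm1 (weight \<omega> v') + \<mu>2 / 2 * (norm (c k + grad (g (Suc k)) - v'))\<^sup>2"
      using assms(13)[of k] by (auto simp: is_arg_min_linorder)
    moreover have "\<mu>3 / 2 * (norm (d k + g (Suc k) - z (Suc k)))\<^sup>2 \<le> \<mu>3 / 2 * (norm (d k + g (Suc k) - z'))\<^sup>2"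
      using z_min[of k z'] z_mem[of k] that by (simp add: ind_fun_def C_def y')
    ultimately show ?thesis
      by (simp only: y' y_def u_def K_def H_def prod.case add_Pair diff_Pair Mq)
  qed
  have y_mem: "y (Suc k) \<in> C" for k
    using z_mem by (simp add: y_def C_def)
  have u_step: "u (Suc k) = u k + K (g (Suc k)) - y (Suc k)" for k
    using assms(15-17) by (simp add: u_def K_def y_def)
  have "K g_star \<in> C"
    using g_star_mem by (simp add: C_def K_def)
  note admm = ADMM_converges[where F = F and H = H and x = g and y = y and u = u, OF K M sym m coercive s H x0 this opt g_min y_mem y_min u_step]
  show ?thesis
    using tendsto_Pair[OF admm] by (simp add: y_def K_def star)
qed

end
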